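(* For any graph $G$ of order $n$ and any positive integer $t$, $\beta(S(G,t))=n^{t-1}\beta(G)$, where $\beta$ denotes the vertex cover number.
   Context: A vertex cover of a graph is a set of vertices meeting every edge; the vertex cover number $\beta(G)$ is the minimum cardinality of a vertex cover of $G$. For a graph $G=(V,E)$ and a positive integer $t$, $V^t$ denotes the set of words $u=u_1u_2\cdots u_t$ of length $t$ over the alphabet $V$. The generalized Sierpiński graph $S(G,t)$ has vertex set $V^t$, and $\{u,v\}$ is an edge if and only if there is $i\in\{1,\dots,t\}$ such that: (i) $u_j=v_j$ for all $j<i$; (ii) $u_i\ne v_i$ and $\{u_i,v_i\}\in E$; (iii) $u_j=v_i$ and $v_j=u_i$ for all $j>i$. *)

theory Defs
  imports "Graph_Theory.Pair_Digraph"
begin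

text \<open>
  A finite simple undirected graph is a \<open>pair_graph\<close>: a finite vertex set with a symmetric,
  irreflexive arc relation. The undirected edge \<open>{u, v}\<close> is represented by the two arcs
  \<open>(u, v)\<close> and \<open>(v, u)\<close>.
\<close>

definition vertex_cover :: "'a pair_pre_digraph \<Rightarrow> 'a set \<Rightarrow> bool" where
  "vertex_cover G C \<longleftrightarrow> C \<subseteq> pverts G \<and> (\<forall>(u, v) \<in> parcs G. u \<in> C \<or> v \<in> C)"

text \<open>Finiteness of \<open>C\<close> is automatic for finite graphs; it excludes the convention that
  infinite sets have cardinality 0.\<close>

definition vertex_cover_number :: "'a pair_pre_digraph \<Rightarrow> nat" where
  "vertex_cover_number G = (LEAST k. \<exists>C. vertex_cover G C \<and> finite C \<and> card C = k)"

text \<open>Words of length \<open>t\<close> are lists of length \<open>t\<close>, so positions run through \<open>0, \<dots>, t - 1\<close>.\<close>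

definition sierpinski_graph :: "'a pair_pre_digraph \<Rightarrow> nat \<Rightarrow> 'a list pair_pre_digraph" where
  "sierpinski_graph G t =
    (let W = {u. set u \<subseteq> pverts G \<and> length u = t} in
      \<lparr> pverts = W,
        parcs = {(u, v). u \<in> W \<and> v \<in> W \<and>
          (\<exists>i<t. (\<forall>j<i. u ! j = v ! j) \<and>
                 u ! i \<noteq> v ! i \<and> (u ! i, v ! i) \<in> parcs G \<and>
                 (\<forall>j. i < j \<and> j < t \<longrightarrow> u ! j = v ! i \<and> v ! j = u ! i))} \<rparr>)"

lemma pair_graph_sierpinski_graph:
  assumes "pair_graph G"
  shows "pair_graph (sierpinski_graph G t)"
proof -
  interpret pair_graph G by fact
  let ?S = "sierpinski_graph G t"
  have fin: "finite (pverts ?S)"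
    using finite_lists_length_eq[OF pair_finite_verts] by (simp add: sierpinski_graph_def)
  have sub: "parcs ?S \<subseteq> pverts ?S \<times> pverts ?S"
    by (auto simp: sierpinski_graph_def Let_def)
  have irr: "u \<noteq> v" if "(u, v) \<in> parcs ?S" for u v
    using that by (auto simp: sierpinski_graph_def Let_def)
  have "sym (parcs G)"
    using sym_arcs by (simp add: symmetric_def arcs_ends_conv)
  then have sym: "(v, u) \<in> parcs ?S" if "(u, v) \<in> parcs ?S" for u v
    using that unfolding sierpinski_graph_def Let_def by simp (metis symD)
  show ?thesis
    using fin sub irr sym finite_subset[OF sub]
    by unfold_locales (auto simp: symmetric_def arcs_ends_conv intro!: symI)
qed

end

theory Submission
  imports Defs
begin

text \<open>
  Fixing all letters but the last splits \<open>V\<^sup>t\<close> into \<open>n\<^sup>t\<^sup>-\<^sup>1\<close> disjoint copies of \<open>G\<close>, each of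
  which needs \<open>\<beta>(G)\<close> vertices. Conversely, the last letters of two adjacent words of \<open>S(G,t)\<close>
  are always adjacent in \<open>G\<close>, so the words ending in a minimum vertex cover of \<open>G\<close> form a
  vertex cover of \<open>S(G,t)\<close>.
\<close>

lemma vertex_cover_number_le:
  assumes "vertex_cover G C" "finite C"
  shows "vertex_cover_number G \<le> card C"
  unfolding vertex_cover_number_def using assms by (intro Least_le) blast

text \<open>The full vertex set is a finite cover, so the \<open>LEAST\<close> in the definition
  ranges over a nonempty set and is attained.\<close>

lemma (in pair_graph) minimum_vertex_cover:
  obtains C where "vertex_cover G C" "card C = vertex_cover_number G"
proof -
  have "vertex_cover G (pverts G)"
    using in_arcsD1 by (auto simp: vertex_cover_def)
  then have "\<exists>k C. vertex_cover G C \<and> finite C \<and> card C = k"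
    using pair_finite_verts by blast
  from LeastI_ex[OF this] show thesis
    using that unfolding vertex_cover_number_def by blast
qed

text \<open>Appending the last letter is injective on pairs \<open>(w, c)\<close>, so
  \<open>D\<close> is in bijection with the disjoint union of its slices over the prefixes
  \<open>w\<close>. Both bounds count a cover this way.\<close>

lemma card_words_by_last:
  assumes "finite V" "D \<subseteq> {u. set u \<subseteq> V \<and> length u = Suc k}"
  shows "card D = (\<Sum>w | set w \<subseteq> V \<and> length w = k. card {c. w @ [c] \<in> D})"
proof -
  let ?W = "{w. set w \<subseteq> V \<and> length w = k}"
  let ?S = "SIGMA w:?W. {c. w @ [c] \<in> D}"
  let ?f = "\<lambda>(w, c). w @ [c]"
  have "u \<in> ?f ` ?S" if "u \<in> D" for u
  proof -
    have "set u \<subseteq> V" "length u = Suc k" using that assms(2) by auto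
    then obtain w c where "u = w @ [c]" "length w = k"
      by (metis length_Suc_conv_rev)
    then show ?thesis using that \<open>set u \<subseteq> V\<close> by (intro image_eqI[of _ _ "(w, c)"]) auto
  qed
  then have "D = ?f ` ?S" by auto
  moreover have "inj_on ?f ?S" by (auto simp: inj_on_def)
  ultimately have "card D = card ?S" using card_image[of ?f ?S] by simp
  also have "\<dots> = (\<Sum>w\<in>?W. card {c. w @ [c] \<in> D})"
  proof (rule card_SigmaI)
    show "finite ?W" using assms(1) by (rule finite_lists_length_eq)
    have "{c. w @ [c] \<in> D} \<subseteq> V" for w using assms(2) by auto
    then show "\<forall>w\<in>?W. finite {c. w @ [c] \<in> D}"
      using assms(1) finite_subset by blast
  qed
  finally show ?thesis .
qed

text \<open>If the words first differ at \<open>i < k\<close>, their last letters are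
  \<open>v ! i\<close> and \<open>u ! i\<close>, the arc at \<open>i\<close> reversed; this is where
  symmetry enters. If \<open>i = k\<close>, they form that arc itself.\<close>

lemma sierpinski_graph_arc_last:
  assumes "sym (parcs G)" "(u, v) \<in> parcs (sierpinski_graph G (Suc k))"
  shows "(u ! k, v ! k) \<in> parcs G"
proof -
  obtain i where "i < Suc k" and i: "(u ! i, v ! i) \<in> parcs G"
    and "\<forall>j. i < j \<and> j < Suc k \<longrightarrow> u ! j = v ! i \<and> v ! j = u ! i"
    using assms(2) by (auto simp: sierpinski_graph_def Let_def)
  then show ?thesis
    using symD[OF assms(1) i] by (cases "i = k") auto
qed

text \<open>With \<open>i = k\<close> no position follows the differing one, so the swapping
  condition is vacuous and each prefix \<open>w\<close> carries a copy of \<open>G\<close>.\<close>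

lemma (in pair_graph) sierpinski_graph_arc_append:
  assumes "set w \<subseteq> pverts G" "length w = k" "(a, b) \<in> parcs G"
  shows "(w @ [a], w @ [b]) \<in> parcs (sierpinski_graph G (Suc k))"
  using assms in_arcsD1[OF assms(3)] in_arcsD2[OF assms(3)] no_loops'
  by (auto simp: sierpinski_graph_def Let_def nth_append intro!: exI[of _ k])

theorem theorem8:
  fixes G :: "'a pair_pre_digraph" and n t :: nat
  assumes "pair_graph G"
    and "card (pverts G) = n"
    and "t \<ge> 1"
  shows "vertex_cover_number (sierpinski_graph G t) = n ^ (t - 1) * vertex_cover_number G"
proof -
  interpret pair_graph G by fact
  \<comment> \<open>Since positions start at 0, \<open>k\<close> is both the prefix length
    \<open>t - 1\<close> and the index of the last letter.\<close>
  obtain k where t: "t = Suc k" using \<open>t \<ge> 1\<close> by (cases t) auto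
  let ?S = "sierpinski_graph G (Suc k)"
  interpret S: pair_graph ?S using assms(1) by (rule pair_graph_sierpinski_graph)
  let ?W = "{w. set w \<subseteq> pverts G \<and> length w = k}"
  have verts: "pverts ?S = {u. set u \<subseteq> pverts G \<and> length u = Suc k}"
    by (simp add: sierpinski_graph_def)
  have card_W: "card ?W = n ^ k"
    using assms(2) card_lists_length_eq[OF pair_finite_verts] by simp
  have "vertex_cover_number ?S \<le> n ^ k * vertex_cover_number G"
  proof -
    obtain C where C: "vertex_cover G C" "card C = vertex_cover_number G"
      by (rule minimum_vertex_cover)
    let ?D = "{u \<in> pverts ?S. u ! k \<in> C}"
    have "sym (parcs G)"
      using sym_arcs by (simp add: symmetric_def arcs_ends_conv)
    then have "vertex_cover ?S ?D"
      using C(1) sierpinski_graph_arc_last[of G] S.in_arcsD1 S.in_arcsD2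
      unfolding vertex_cover_def by fast
    then have "vertex_cover_number ?S \<le> card ?D"
      using S.pair_finite_verts by (intro vertex_cover_number_le) auto
    also have "\<dots> = (\<Sum>w\<in>?W. card {c. w @ [c] \<in> ?D})"
      using pair_finite_verts by (intro card_words_by_last) (auto simp: verts)
    also have "\<dots> = (\<Sum>w\<in>?W. card C)"
    proof (rule sum.cong[OF refl])
      fix w assume "w \<in> ?W"
      \<comment> \<open>Equality needs \<open>C \<subseteq> pverts G\<close>, so that appending a
        letter of \<open>C\<close> yields a vertex of \<open>?S\<close>.\<close>
      then have "{c. w @ [c] \<in> ?D} = C"
        using C(1) by (auto simp: verts vertex_cover_def nth_append)
      then show "card {c. w @ [c] \<in> ?D} = card C" by simp
    qed
    finally show ?thesis using C(2) card_W by simp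
  qed
  moreover have "n ^ k * vertex_cover_number G \<le> vertex_cover_number ?S"
  proof -
    obtain D where D: "vertex_cover ?S D" "card D = vertex_cover_number ?S"
      by (rule S.minimum_vertex_cover)
    have sub: "D \<subseteq> {u. set u \<subseteq> pverts G \<and> length u = Suc k}"
      using D(1) by (simp add: vertex_cover_def verts)
    have "n ^ k * vertex_cover_number G = (\<Sum>w\<in>?W. vertex_cover_number G)"
      using card_W by simp
    also have "\<dots> \<le> (\<Sum>w\<in>?W. card {c. w @ [c] \<in> D})"
    proof (rule sum_mono)
      fix w assume w: "w \<in> ?W"
      \<comment> \<open>The slice at \<open>w\<close> is the trace of \<open>D\<close> on the copy
        of \<open>G\<close> with prefix \<open>w\<close>. It covers \<open>G\<close> because every
        arc of that copy is an arc of \<open>?S\<close>.\<close>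
      have slice: "{c. w @ [c] \<in> D} \<subseteq> pverts G" using sub by auto
      moreover have "w @ [a] \<in> D \<or> w @ [b] \<in> D" if "(a, b) \<in> parcs G" for a b
        using sierpinski_graph_arc_append[of w k a b] w that D(1)
        by (auto simp: vertex_cover_def)
      ultimately have "vertex_cover G {c. w @ [c] \<in> D}"
        by (auto simp: vertex_cover_def)
      then show "vertex_cover_number G \<le> card {c. w @ [c] \<in> D}"
        using finite_subset[OF slice pair_finite_verts] by (rule vertex_cover_number_le)
    qed
    also have "\<dots> = card D"
      using card_words_by_last[OF pair_finite_verts sub] by simp
    finally show ?thesis using D(2) by simp
  qed
  ultimately show ?thesis by (simp add: t)
qed

end
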